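(* Let $n\ge1$ and $\alpha$ a Dyck path of length $2n$. Then \[\sum_{w\in\mathfrak{S}_{2n}:\,p_A(w)=\alpha} q^{aa(w)}t^{z(w)}=[2]_t[4]_t[6]_t\cdots[2n]_t\prod_{i=1}^n[h_i(\alpha)]_q,\] where $q,t$ are formal variables and $[h]_q=1+q+\dots+q^{h-1}$.
   Context: A Dyck path of length $2N$ is a lattice path from $(0,0)$ to $(2N,0)$ with steps $(1,1)$ (up) and $(1,-1)$ (down) staying weakly above the $x$-axis; the down step ending at $x$-coordinate $k$ and going from height $h$ to $h-1$ is at position $k$ with height $h$; the path is determined by its set of down-step positions. $h_i(p)$ is the height of the $i$th down step of $p$. Crossout procedure: for $w\in\mathfrak{S}_{2n}$ in one-line notation, repeat until all positions are marked: mark "B" at the unmarked position $i$ with smallest value $w(i)$, then mark "A" at the leftmost unmarked position. $\mathcal{A}(w)$, $\mathcal{B}(w)$ are the sets of positions marked A and B. $p_A(w)$ is the Dyck path of length $2n$ with down-step positions $\{w(a):a\in\mathcal{A}(w)\}$. $aa(w)$ is the number of pairs of positions $i<j$, both marked A, with $w(i)>w(j)$. $z(w)=\#\{(i,j): i<j,\ w(i)<w(j),\ i\in\mathcal{B}(w)\}$. *)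

theory Defs
  imports
    "HOL-Combinatorics.Permutations"
    "HOL-Computational_Algebra.Polynomial"
begin

section \<open>Dyck paths\<close>

datatype step = Up | Down

fun step_val :: "step \<Rightarrow> int" where
  "step_val Up = 1"
| "step_val Down = -1"

definition path_height :: "step list \<Rightarrow> nat \<Rightarrow> int" where
  "path_height p x = (\<Sum>s\<leftarrow>take x p. step_val s)"

definition dyck_path :: "nat \<Rightarrow> step list \<Rightarrow> bool" where
  "dyck_path N p \<longleftrightarrow>
     length p = 2 * N \<and> path_height p (2 * N) = 0 \<and> (\<forall>x\<le>2 * N. path_height p x \<ge> 0)"

text \<open>The step ending at \<open>x\<close>-coordinate \<open>k\<close> is the list element with index \<open>k - 1\<close>.\<close>

definition down_positions :: "step list \<Rightarrow> nat set" where
  "down_positions p = {k \<in> {1..length p}. p ! (k - 1) = Down}"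

text \<open>The \<open>i\<close>th down step is counted from \<open>i = 1\<close>; its height is the height at which it starts.\<close>

definition down_height :: "step list \<Rightarrow> nat \<Rightarrow> nat" where
  "down_height p i = nat (path_height p (sorted_list_of_set (down_positions p) ! (i - 1) - 1))"

definition path_of_downs :: "nat \<Rightarrow> nat set \<Rightarrow> step list" where
  "path_of_downs N S = map (\<lambda>k. if k \<in> S then Down else Up) [1..<2 * N + 1]"


section \<open>The crossout procedure\<close>

text \<open>
  A state is the pair of the sets of positions marked A and B. Every round marks two of the
  \<open>2 * n\<close> positions, so all positions are marked after exactly \<open>n\<close> rounds
  (see \<open>crossout_marks_all\<close> below).
\<close>

definition crossout_round :: "nat \<Rightarrow> (nat \<Rightarrow> nat) \<Rightarrow> nat set \<times> nat set \<Rightarrow> nat set \<times> nat set" where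
  "crossout_round n w = (\<lambda>(A, B).
     let U = {1..2 * n} - (A \<union> B);
         b = arg_min_on w U;
         a = Min (U - {b})
     in (insert a A, insert b B))"

definition crossout :: "nat \<Rightarrow> (nat \<Rightarrow> nat) \<Rightarrow> nat set \<times> nat set" where
  "crossout n w = (crossout_round n w ^^ n) ({}, {})"

definition marked_A :: "nat \<Rightarrow> (nat \<Rightarrow> nat) \<Rightarrow> nat set" where
  "marked_A n w = fst (crossout n w)"

definition marked_B :: "nat \<Rightarrow> (nat \<Rightarrow> nat) \<Rightarrow> nat set" where
  "marked_B n w = snd (crossout n w)"

definition p_A :: "nat \<Rightarrow> (nat \<Rightarrow> nat) \<Rightarrow> step list" where
  "p_A n w = path_of_downs n (w ` marked_A n w)"

definition aa :: "nat \<Rightarrow> (nat \<Rightarrow> nat) \<Rightarrow> nat" where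
  "aa n w = card {(i, j). i \<in> marked_A n w \<and> j \<in> marked_A n w \<and> i < j \<and> w i > w j}"

definition z :: "nat \<Rightarrow> (nat \<Rightarrow> nat) \<Rightarrow> nat" where
  "z n w = card {(i, j). i \<in> {1..2 * n} \<and> j \<in> {1..2 * n} \<and> i < j \<and> w i < w j \<and> i \<in> marked_B n w}"


section \<open>Formal variables and \<open>q\<close>-numbers\<close>

text \<open>The polynomial ring in \<open>q\<close> and \<open>t\<close> over the integers is represented as polynomials in
  \<open>q\<close> whose coefficients are polynomials in \<open>t\<close>.\<close>

definition q_var :: "int poly poly" where
  "q_var = [:0, 1:]"

definition t_var :: "int poly poly" where
  "t_var = [:[:0, 1:]:]"

definition q_number :: "nat \<Rightarrow> 'a::comm_semiring_1 \<Rightarrow> 'a" where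
  "q_number m x = (\<Sum>k<m. x ^ k)"


section \<open>Well-definedness\<close>

lemma down_positions_path_of_downs:
  assumes "S \<subseteq> {1..2 * N}"
  shows "down_positions (path_of_downs N S) = S"
proof -
  have "path_of_downs N S ! (k - 1) = (if k \<in> S then Down else Up)" if "k \<in> {1..2 * N}" for k
    using that by (auto simp: path_of_downs_def simp del: upt_Suc)
  then have "k \<in> down_positions (path_of_downs N S) \<longleftrightarrow> k \<in> {1..2 * N} \<and> k \<in> S" for k
    by (auto simp: down_positions_def path_of_downs_def simp del: upt_Suc split: if_splits)
  then show ?thesis
    using assms by blast
qed

lemma path_height_path_of_downs:
  assumes "x \<le> 2 * N"
  shows "path_height (path_of_downs N S) x
           = int (card ({1..x} - S)) - int (card ({1..x} \<inter> S))"
  using assms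
proof (induction x)
  case 0
  then show ?case by (simp add: path_height_def)
next
  case (Suc x)
  have len: "length (path_of_downs N S) = 2 * N"
    by (simp add: path_of_downs_def)
  have nth: "path_of_downs N S ! x = (if Suc x \<in> S then Down else Up)"
    using Suc.prems by (auto simp: path_of_downs_def simp del: upt_Suc)
  have "path_height (path_of_downs N S) (Suc x)
      = path_height (path_of_downs N S) x + step_val (path_of_downs N S ! x)"
    using Suc.prems len by (simp add: path_height_def take_Suc_conv_app_nth)
  moreover have "{1..Suc x} = insert (Suc x) {1..x}"
    by auto
  ultimately show ?case
    using Suc nth by (simp add: insert_Diff_if Int_insert_left)
qed

lemma crossout_invariant:
  assumes w: "w permutes {1..2 * n}" and "k \<le> n"
    and "(crossout_round n w ^^ k) ({}, {}) = (A, B)"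
  shows "A \<union> B \<subseteq> {1..2 * n} \<and> A \<inter> B = {} \<and> card A = k \<and> card B = k \<and>
         (\<forall>m. card {a \<in> A. w a \<le> m} \<le> card {b \<in> B. w b \<le> m})"
  using assms(2,3)
proof (induction k arbitrary: A B)
  case 0
  then show ?case by simp
next
  case (Suc k)
  obtain A' B' where AB': "(crossout_round n w ^^ k) ({}, {}) = (A', B')"
    by fastforce
  have IH: "A' \<union> B' \<subseteq> {1..2 * n}" "A' \<inter> B' = {}" "card A' = k" "card B' = k"
    and le: "\<And>m. card {a \<in> A'. w a \<le> m} \<le> card {b \<in> B'. w b \<le> m}"
    using Suc.IH[OF _ AB'] Suc.prems(1) by auto
  have fin: "finite A'" "finite B'"
    using IH(1) by (auto intro: finite_subset)
  define U where "U = {1..2 * n} - (A' \<union> B')"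
  define b where "b = arg_min_on w U"
  define a where "a = Min (U - {b})"
  have AB: "A = insert a A'" "B = insert b B'"
    using Suc.prems(2) AB' by (auto simp: crossout_round_def Let_def U_def b_def a_def)
  have finU: "finite U"
    by (simp add: U_def)
  have "card U = 2 * n - 2 * k"
    using IH fin by (simp add: U_def card_Diff_subset card_Un_disjoint)
  then have cU: "card U \<ge> 2"
    using Suc.prems(1) by simp
  then have "U \<noteq> {}"
    by auto
  then have bU: "b \<in> U" and bmin: "\<And>x. x \<in> U \<Longrightarrow> w b \<le> w x"
    using arg_min_if_finite[OF finU, of w] by (force simp: b_def not_less)+
  have "U - {b} \<noteq> {}"
  proof
    assume "U - {b} = {}"
    then have "card U \<le> card {b}"
      by (intro card_mono) auto
    with cU show False by simp
  qed
  then have aU: "a \<in> U" "a \<noteq> b"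
    using Min_in[of "U - {b}"] finU by (auto simp: a_def)
  have notin: "a \<notin> A'" "a \<notin> B'" "b \<notin> A'" "b \<notin> B'" "a \<in> {1..2 * n}" "b \<in> {1..2 * n}"
    using aU bU by (auto simp: U_def)
  have "card {x \<in> A. w x \<le> m} \<le> card {x \<in> B. w x \<le> m}" for m
  proof -
    have 1: "{x \<in> A. w x \<le> m} = (if w a \<le> m then insert a {x \<in> A'. w x \<le> m} else {x \<in> A'. w x \<le> m})"
      by (auto simp: AB)
    have 2: "{x \<in> B. w x \<le> m} = (if w b \<le> m then insert b {x \<in> B'. w x \<le> m} else {x \<in> B'. w x \<le> m})"
      by (auto simp: AB)
    show ?thesis
      unfolding 1 2 using le[of m] bmin[OF aU(1)] notin fin by auto
  qed
  then show ?case
    using IH notin fin aU(2) by (auto simp: AB)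
qed

lemma crossout_marks_all:
  assumes "w permutes {1..2 * n}"
  shows "marked_A n w \<union> marked_B n w = {1..2 * n}" and "marked_A n w \<inter> marked_B n w = {}"
proof -
  have "(crossout_round n w ^^ n) ({}, {}) = (marked_A n w, marked_B n w)"
    by (simp add: marked_A_def marked_B_def crossout_def)
  note inv = crossout_invariant[OF assms order_refl this]
  then have fin: "finite (marked_A n w)" "finite (marked_B n w)"
    by (auto intro: finite_subset)
  show "marked_A n w \<inter> marked_B n w = {}"
    using inv by blast
  show "marked_A n w \<union> marked_B n w = {1..2 * n}"
    using inv fin by (intro card_subset_eq) (auto simp: card_Un_disjoint)
qed

lemma down_positions_p_A:
  assumes "w permutes {1..2 * n}"
  shows "down_positions (p_A n w) = w ` marked_A n w"
  unfolding p_A_def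
  using crossout_marks_all(1)[OF assms] permutes_image[OF assms]
  by (intro down_positions_path_of_downs) blast

lemma dyck_path_p_A:
  assumes w: "w permutes {1..2 * n}"
  shows "dyck_path n (p_A n w)"
proof -
  let ?A = "marked_A n w" and ?B = "marked_B n w"
  have "(crossout_round n w ^^ n) ({}, {}) = (?A, ?B)"
    by (simp add: marked_A_def marked_B_def crossout_def)
  note inv = crossout_invariant[OF assms order_refl this]
  have inj: "inj w"
    using w by (rule permutes_inj)
  have img: "w ` ?A \<union> w ` ?B = {1..2 * n}"
    using crossout_marks_all(1)[OF w] permutes_image[OF w] by (metis image_Un)
  have disj: "w ` ?A \<inter> w ` ?B = {}"
    using crossout_marks_all(2)[OF w] inj by (metis image_Int image_empty)
  have height: "path_height (p_A n w) x
      = int (card {b \<in> ?B. w b \<le> x}) - int (card {a \<in> ?A. w a \<le> x})" if "x \<le> 2 * n" for x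
  proof -
    have "{1..x} \<inter> w ` ?A = w ` {a \<in> ?A. w a \<le> x}"
      using img by auto
    moreover have "{1..x} - w ` ?A = w ` {b \<in> ?B. w b \<le> x}"
    proof
      show "{1..x} - w ` ?A \<subseteq> w ` {b \<in> ?B. w b \<le> x}"
      proof
        fix y assume y: "y \<in> {1..x} - w ` ?A"
        then have "y \<in> {1..2 * n}" using that by auto
        then have "y \<in> w ` ?B" using img y by blast
        then show "y \<in> w ` {b \<in> ?B. w b \<le> x}" using y by auto
      qed
      show "w ` {b \<in> ?B. w b \<le> x} \<subseteq> {1..x} - w ` ?A"
      proof
        fix y assume "y \<in> w ` {b \<in> ?B. w b \<le> x}"
        then have y: "y \<in> w ` ?B" "y \<le> x" by auto
        then have "y \<in> {1..2 * n}" "y \<notin> w ` ?A" using img disj by blast+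
        then show "y \<in> {1..x} - w ` ?A" using y by auto
      qed
    qed
    moreover have "card (w ` S) = card S" for S
      using inj by (metis card_image inj_on_subset subset_UNIV)
    ultimately show ?thesis
      unfolding p_A_def using path_height_path_of_downs[OF that, of "w ` ?A"] by simp
  qed
  have "{b \<in> ?B. w b \<le> 2 * n} = ?B" "{a \<in> ?A. w a \<le> 2 * n} = ?A"
    using img by auto
  then have "path_height (p_A n w) (2 * n) = 0"
    using height[of "2 * n"] inv by simp
  moreover have "path_height (p_A n w) x \<ge> 0" if "x \<le> 2 * n" for x
    using height[OF that] inv by simp
  moreover have "length (p_A n w) = 2 * n"
    by (simp add: p_A_def path_of_downs_def)
  ultimately show ?thesis
    by (simp add: dyck_path_def)
qed

end

theory Submission
  imports Defs
begin

text \<open>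
  Let \<open>b\<close> and \<open>a\<close> be the positions marked in the first round. Position \<open>b\<close> carries the
  smallest value and is otherwise arbitrary; it contributes to \<open>z\<close> the number of positions to its
  right, which yields a factor \<open>[2n]\<close> in \<open>t\<close>. Position \<open>a\<close> is then the leftmost remaining one and
  carries an arbitrary down-step position \<open>v\<close>; since \<open>a\<close> precedes all other A-positions, it
  contributes to \<open>aa\<close> the number of down steps to the left of \<open>v\<close>. Deleting both leaves a smaller
  instance, in which the heights of the down steps before \<open>v\<close> have dropped by one. Summing over \<open>v\<close>,
  the products of heights telescope because \<open>[h] = 1 + q [h - 1]\<close>. For the induction, positions and
  values range over arbitrary finite sets, and \<open>D\<close> over arbitrary sets of values: if \<open>D\<close> is not the
  set of down steps of a Dyck path, both sides vanish.
\<close>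

section \<open>Identities for q-numbers\<close>

lemma q_number_0 [simp]: "q_number 0 x = 0"
  by (simp add: q_number_def)

lemma q_number_Suc: "q_number (Suc m) x = 1 + x * q_number m x"
  unfolding q_number_def by (subst sum.lessThan_Suc_shift) (simp add: sum_distrib_left)

lemma q_number_Suc': "q_number (Suc m) x = q_number m x + x ^ m"
  by (simp add: q_number_def)

text \<open>The exponents run once through 0, ..., \<open>card P - 1\<close>. In the induction a new
  minimum has the whole old set above it and leaves all other counts unchanged, so it adds exactly
  the top power. This yields the factor in \<open>t\<close> of one round, \<open>b\<close> being the
  position of the least value.\<close>

lemma sum_power_card_greater:
  fixes P :: "nat set" and x :: "'a::comm_semiring_1"
  assumes "finite P"
  shows "(\<Sum>b\<in>P. x ^ card {j \<in> P. b < j}) = q_number (card P) x"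
  using assms
proof (induction P rule: finite_linorder_min_induct)
  case empty
  then show ?case by simp
next
  case (insert b A)
  have b: "b \<notin> A" using insert by auto
  have "{j \<in> insert b A. b < j} = A" using insert by auto
  moreover have "{j \<in> insert b A. c < j} = {j \<in> A. c < j}" if "c \<in> A" for c
    using insert that by auto
  ultimately show ?case
    using insert b by (simp add: q_number_Suc' add.commute)
qed

text \<open>With \<open>h d = f d - j - #{e < d}\<close> this is repeated use of \<open>[h] = 1 + q [h - 1]\<close>, starting at
  the smallest element; it stops at the first element where \<open>h d = 1\<close>.\<close>

lemma telescoping_q_numbers:
  fixes D :: "nat set" and f :: "nat \<Rightarrow> nat" and q :: "'a::comm_semiring_1"
  assumes "finite D" and "D \<noteq> {}" and "mono f"
    and "\<And>d. d \<in> D \<Longrightarrow> j < f d" and "\<And>d. d \<in> D \<Longrightarrow> f d \<le> j + card D"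
  shows "(\<Sum>v\<in>D. q ^ card {e \<in> D. e < v} *
            ((\<Prod>d | d \<in> D \<and> d < v. q_number (f d - j - card {e \<in> D. e < d} - 1) q) *
             (\<Prod>d | d \<in> D \<and> v < d. q_number (f d - j - card {e \<in> D. e < d}) q)))
         = (\<Prod>d\<in>D. q_number (f d - j - card {e \<in> D. e < d}) q)"
  using assms(1,2,4,5)
proof (induction D arbitrary: j rule: finite_linorder_min_induct)
  case empty
  then show ?case by simp
next
  case (insert b A)
  let ?D = "insert b A"
  let ?h = "\<lambda>d. f d - j - card {e \<in> ?D. e < d}"
  \<comment> \<open>Dropping the minimum \<open>b\<close> lowers each count of smaller elements by
    one; passing from \<open>j\<close> to \<open>Suc j\<close> compensates, so \<open>?h\<close> and
    \<open>?k\<close> agree on \<open>A\<close>.\<close>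
  let ?k = "\<lambda>d. f d - Suc j - card {e \<in> A. e < d}"
  let ?L = "\<lambda>v. \<Prod>d | d \<in> ?D \<and> d < v. q_number (?h d - 1) q"
  let ?R = "\<lambda>v. \<Prod>d | d \<in> ?D \<and> v < d. q_number (?h d) q"
  let ?L' = "\<lambda>v. \<Prod>d | d \<in> A \<and> d < v. q_number (?k d - 1) q"
  let ?R' = "\<lambda>v. \<Prod>d | d \<in> A \<and> v < d. q_number (?k d) q"
  have bA: "b \<notin> A" and fin: "finite A" using insert by auto
  have eb: "{e \<in> ?D. e < b} = {}" using insert by auto
  have ed: "{e \<in> ?D. e < d} = insert b {e \<in> A. e < d}" if "d \<in> A" for d
    using insert that by auto
  have cd: "card {e \<in> ?D. e < d} = Suc (card {e \<in> A. e < d})" if "d \<in> A" for d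
    unfolding ed[OF that] using bA fin by simp
  have hb: "?h b = f b - j" unfolding eb by simp
  have hd: "?h d = ?k d" if "d \<in> A" for d
    unfolding cd[OF that] by simp
  have Lb: "?L b = 1"
    unfolding eb by simp
  have Rb: "?R b = (\<Prod>d\<in>A. q_number (?k d) q)"
  proof (rule prod.cong)
    show "{d. d \<in> ?D \<and> b < d} = A" using insert.hyps by auto
  qed (simp only: hd)
  have Lv: "?L v = q_number (f b - j - 1) q * ?L' v" if v: "v \<in> A" for v
  proof -
    have "{d. d \<in> ?D \<and> d < v} = insert b {d. d \<in> A \<and> d < v}"
      using insert.hyps v by auto
    then have "?L v = q_number (?h b - 1) q * (\<Prod>d | d \<in> A \<and> d < v. q_number (?h d - 1) q)"
      using bA fin by simp
    also have "(\<Prod>d | d \<in> A \<and> d < v. q_number (?h d - 1) q) = ?L' v"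
      by (rule prod.cong) (use hd in auto)
    finally show ?thesis by (simp only: hb)
  qed
  have Rv: "?R v = ?R' v" if v: "v \<in> A" for v
  proof (rule prod.cong)
    show "{d. d \<in> ?D \<and> v < d} = {d. d \<in> A \<and> v < d}"
      using insert.hyps v by auto
  qed (use hd in auto)
  let ?S = "\<Sum>v\<in>A. q ^ card {e \<in> A. e < v} * (?L' v * ?R' v)"
  let ?T = "\<Prod>d\<in>A. q_number (?k d) q"
  have "(\<Sum>v\<in>A. q ^ card {e \<in> ?D. e < v} * (?L v * ?R v))
      = (\<Sum>v\<in>A. q * q_number (f b - j - 1) q * (q ^ card {e \<in> A. e < v} * (?L' v * ?R' v)))"
  proof (rule sum.cong[OF refl])
    fix v assume v: "v \<in> A"
    show "q ^ card {e \<in> ?D. e < v} * (?L v * ?R v)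
        = q * q_number (f b - j - 1) q * (q ^ card {e \<in> A. e < v} * (?L' v * ?R' v))"
      unfolding Lv[OF v] Rv[OF v] cd[OF v] by (simp add: mult_ac)
  qed
  then have lhs: "(\<Sum>v\<in>?D. q ^ card {e \<in> ?D. e < v} * (?L v * ?R v))
      = ?T + q * q_number (f b - j - 1) q * ?S"
    unfolding sum.insert[OF fin bA] Lb Rb by (simp only: sum_distrib_left eb) simp
  have "(\<Prod>d\<in>A. q_number (?h d) q) = ?T"
    by (rule prod.cong) (use hd in auto)
  then have rhs: "(\<Prod>d\<in>?D. q_number (?h d) q) = q_number (f b - j) q * ?T"
    unfolding prod.insert[OF fin bA] hb by simp
  have "j < f b" using insert.prems by auto
  then have Suc: "f b - j = Suc (f b - j - 1)" by simp
  show ?case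
  \<comment> \<open>If the height at \<open>b\<close> is 1, the factor
    \<open>q_number (f b - j - 1) q\<close> is zero and only the term \<open>v = b\<close> survives.
    Otherwise the induction hypothesis turns \<open>?S\<close> into \<open>?T\<close>, and the two
    contributions add up to \<open>1 + q [h - 1] = [h]\<close> times \<open>?T\<close>.\<close>
  proof (cases "f b = Suc j")
    case True
    then show ?thesis unfolding lhs rhs by (simp add: q_number_Suc)
  next
    case False
    with \<open>j < f b\<close> have fb: "Suc j < f b" by simp
    \<comment> \<open>For a single remaining element the upper bound on \<open>f\<close> forces
      height at most 1, so the recursion always ends in the other case.\<close>
    have "A \<noteq> {}"
      using insert.prems(3)[of b] fb by auto
    moreover have "Suc j < f d" if "d \<in> A" for d
      using fb insert.hyps(2) that \<open>mono f\<close> by (meson less_imp_le less_le_trans monoD)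
    moreover have "f d \<le> Suc j + card A" if "d \<in> A" for d
      using insert.prems(3)[of d] that bA fin by simp
    ultimately have "?S = ?T"
      by (rule insert.IH)
    then show ?thesis
      unfolding lhs rhs by (subst Suc) (simp add: q_number_Suc algebra_simps)
  qed
qed

section \<open>Bijections and their decomposition by the first round\<close>

text \<open>Bijections \<open>P \<rightarrow> V\<close>, extended by the identity so that \<open>bijs P P\<close> is the set of permutations.\<close>

definition bijs :: "nat set \<Rightarrow> nat set \<Rightarrow> (nat \<Rightarrow> nat) set" where
  "bijs P V = {w. bij_betw w P V \<and> (\<forall>x. x \<notin> P \<longrightarrow> w x = x)}"

lemma bijs_self: "bijs S S = {w. w permutes S}"
  by (auto simp: bijs_def permutes_imp_bij permutes_not_in intro: bij_imp_permutes)

lemma finite_bijs: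
  assumes "finite P" and "finite V"
  shows "finite (bijs P V)"
proof (rule finite_subset)
  show "bijs P V \<subseteq> (\<lambda>f x. if x \<in> P then f x else x) ` (P \<rightarrow>\<^sub>E V)"
  proof
    fix w assume w: "w \<in> bijs P V"
    show "w \<in> (\<lambda>f x. if x \<in> P then f x else x) ` (P \<rightarrow>\<^sub>E V)"
    proof (rule image_eqI[where x = "restrict w P"])
      show "w = (\<lambda>x. if x \<in> P then restrict w P x else x)"
        using w by (auto simp: bijs_def)
      show "restrict w P \<in> P \<rightarrow>\<^sub>E V"
        using w by (auto simp: bijs_def bij_betw_def)
    qed
  qed
  show "finite ((\<lambda>f x. if x \<in> P then f x else x) ` (P \<rightarrow>\<^sub>E V))"
    using assms by (intro finite_imageI finite_PiE) auto
qed

lemma Min_Diff_singleton_in: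
  fixes P :: "'a::linorder set"
  assumes "finite P" and "card P \<ge> 2"
  shows "Min (P - {b}) \<in> P - {b}"
proof (rule Min_in)
  show "P - {b} \<noteq> {}"
  proof
    assume "P - {b} = {}"
    then have "card P \<le> card {b}" by (intro card_mono) auto
    with assms show False by simp
  qed
qed (use assms in simp)

text \<open>A bijection amounts to the position \<open>b\<close> of the value \<open>m\<close>, the
  value \<open>v\<close> at the leftmost other position, and a bijection between what is left. With
  \<open>m\<close> the least value, these are the positions and values used by the first crossout
  round.\<close>

lemma bij_betw_bijs_extend:
  fixes P V :: "nat set"
  assumes "finite P" and card: "card P \<ge> 2" and m: "m \<in> V"
  shows "bij_betw (\<lambda>(b, v, w). w(b := m, Min (P - {b}) := v))
           (SIGMA b:P. SIGMA v:V - {m}. bijs (P - {Min (P - {b}), b}) (V - {m, v})) (bijs P V)"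
proof -
  note a = Min_Diff_singleton_in[OF assms(1,2)]
  let ?S = "SIGMA b:P. SIGMA v:V - {m}. bijs (P - {Min (P - {b}), b}) (V - {m, v})"
  let ?f = "\<lambda>(b, v, w). w(b := m, Min (P - {b}) := v)"
  \<comment> \<open>The inverse resets \<open>b\<close> and \<open>a\<close> to themselves, since
    members of \<open>bijs\<close> fix every point outside their domain.\<close>
  let ?g = "\<lambda>w. let b = the_inv_into P w m; a = Min (P - {b}) in (b, w a, w(b := b, a := a))"
  have fwd: "?f x \<in> bijs P V \<and> ?g (?f x) = x" if "x \<in> ?S" for x
  proof -
    obtain b v w where x: "x = (b, v, w)" by (cases x)
    with that have b: "b \<in> P" and v: "v \<in> V" "v \<noteq> m"
      and w: "w \<in> bijs (P - {Min (P - {b}), b}) (V - {m, v})" by auto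
    define a where "a = Min (P - {b})"
    define u where "u = w(b := m, a := v)"
    have ab: "a \<in> P" "a \<noteq> b" using a[of b] by (auto simp: a_def)
    have wb: "bij_betw w (P - {a, b}) (V - {m, v})" "\<And>x. x \<notin> P - {a, b} \<Longrightarrow> w x = x"
      using w by (auto simp: bijs_def a_def)
    have "bij_betw u (P - {a, b}) (V - {m, v})"
      using wb(1) by (rule bij_betw_cong[THEN iffD1, rotated]) (auto simp: u_def)
    moreover have "bij_betw u {a, b} {m, v}"
      using ab v by (auto simp: u_def bij_betw_def inj_on_def)
    ultimately have "bij_betw u ((P - {a, b}) \<union> {a, b}) ((V - {m, v}) \<union> {m, v})"
      by (rule bij_betw_combine) auto
    moreover have "(P - {a, b}) \<union> {a, b} = P" "(V - {m, v}) \<union> {m, v} = V"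
      using ab b v m by auto
    ultimately have u: "bij_betw u P V" by simp
    have "u x = x" if "x \<notin> P" for x
      using that ab b wb(2) by (auto simp: u_def)
    with u have "u \<in> bijs P V" by (auto simp: bijs_def)
    moreover have "the_inv_into P u m = b"
      using u b ab by (intro the_inv_into_f_eq) (auto simp: bij_betw_def u_def)
    moreover have "u(b := b, a := a) = w"
      using wb(2)[of a] wb(2)[of b] by (auto simp: u_def fun_eq_iff)
    moreover have "u a = v" by (simp add: u_def)
    ultimately show ?thesis
      by (simp add: x Let_def flip: a_def u_def)
  qed
  have bwd: "?g w \<in> ?S \<and> ?f (?g w) = w" if "w \<in> bijs P V" for w
  proof -
    have w: "bij_betw w P V" "\<And>x. x \<notin> P \<Longrightarrow> w x = x" using that by (auto simp: bijs_def)
    define b where "b = the_inv_into P w m"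
    define a where "a = Min (P - {b})"
    have b: "b \<in> P" "w b = m"
      using w(1) m unfolding b_def
      by (auto simp: bij_betw_def intro!: the_inv_into_into f_the_inv_into_f)
    have ab: "a \<in> P" "a \<noteq> b" using a[of b] by (auto simp: a_def)
    have inj: "inj_on w P" using w(1) by (simp add: bij_betw_def)
    have wa: "w a \<noteq> m" "w a \<in> V"
      using ab b inj w(1) by (auto simp: bij_betw_def dest: inj_onD)
    have "bij_betw w (P - {a, b}) (V - {m, w a})"
    proof -
      have "w ` (P - {a, b}) = w ` P - w ` {a, b}"
        using inj ab b by (intro inj_on_image_set_diff) auto
      also have "\<dots> = V - {m, w a}"
        using w(1) b by (auto simp: bij_betw_def)
      finally show ?thesis
        using inj by (auto simp: bij_betw_def intro: inj_on_subset)
    qed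
    then have "bij_betw (w(b := b, a := a)) (P - {a, b}) (V - {m, w a})"
      by (rule bij_betw_cong[THEN iffD1, rotated]) auto
    then have u: "w(b := b, a := a) \<in> bijs (P - {a, b}) (V - {m, w a})"
      using w(2) by (auto simp: bijs_def)
    have g: "?g w = (b, w a, w(b := b, a := a))"
      by (simp add: Let_def flip: a_def b_def)
    have "(w(b := b, a := a))(b := m, a := w a) = w"
      using b by (auto simp: fun_eq_iff)
    then show ?thesis
      unfolding g using u wa b by (simp flip: a_def)
  qed
  show ?thesis
    by (rule bij_betw_byWitness[where f' = ?g]) (use fwd bwd in blast)+
qed

section \<open>The crossout procedure as a recursion on the unmarked positions\<close>

fun cross :: "nat \<Rightarrow> (nat \<Rightarrow> nat) \<Rightarrow> nat set \<Rightarrow> nat set \<times> nat set" where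
  "cross 0 w P = ({}, {})"
| "cross (Suc k) w P =
     (let b = arg_min_on w P; a = Min (P - {b}); (A, B) = cross k w (P - {a, b})
      in (insert a A, insert b B))"

text \<open>The initial state is arbitrary because the induction peels off the first round, after
  which the accumulated sets are no longer empty.\<close>

lemma funpow_crossout_round:
  "(crossout_round n w ^^ k) (A, B)
     = (A \<union> fst (cross k w ({1..2 * n} - (A \<union> B))), B \<union> snd (cross k w ({1..2 * n} - (A \<union> B))))"
proof (induction k arbitrary: A B)
  case 0
  then show ?case by simp
next
  case (Suc k)
  let ?U = "{1..2 * n} - (A \<union> B)"
  define b where "b = arg_min_on w ?U"
  define a where "a = Min (?U - {b})"
  have "crossout_round n w (A, B) = (insert a A, insert b B)"
    by (simp add: crossout_round_def Let_def a_def b_def)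
  moreover have "{1..2 * n} - (insert a A \<union> insert b B) = ?U - {a, b}"
    by auto
  moreover have "cross (Suc k) w ?U
      = (insert a (fst (cross k w (?U - {a, b}))), insert b (snd (cross k w (?U - {a, b}))))"
    by (simp only: cross.simps Let_def a_def b_def case_prod_unfold)
  ultimately show ?case
    unfolding funpow_Suc_right o_apply by (simp only: Suc.IH) auto
qed

lemma marked_cross:
  "marked_A n w = fst (cross n w {1..2 * n})" "marked_B n w = snd (cross n w {1..2 * n})"
  by (simp_all add: marked_A_def marked_B_def crossout_def funpow_crossout_round)

lemma arg_min_on_cong:
  assumes "\<And>x. x \<in> P \<Longrightarrow> f x = g x"
  shows "arg_min_on f P = arg_min_on g P"
proof -
  have "is_arg_min f (\<lambda>x. x \<in> P) = is_arg_min g (\<lambda>x. x \<in> P)"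
    using assms by (auto simp: is_arg_min_def fun_eq_iff)
  then show ?thesis by (simp add: arg_min_on_def arg_min_def)
qed

text \<open>Strict minimality makes the minimizer unique, so the choice inside
  \<open>arg_min_on\<close> can only return \<open>b\<close>.\<close>

lemma arg_min_on_eqI:
  fixes f :: "'a \<Rightarrow> 'b::linorder"
  assumes "b \<in> P" and "\<And>x. x \<in> P \<Longrightarrow> x \<noteq> b \<Longrightarrow> f b < f x"
  shows "arg_min_on f P = b"
  unfolding arg_min_on_def arg_min_def
proof (rule some_equality)
  show "is_arg_min f (\<lambda>x. x \<in> P) b"
    using assms by (force simp: is_arg_min_def)
  show "x = b" if "is_arg_min f (\<lambda>x. x \<in> P) x" for x
    using assms that by (force simp: is_arg_min_def)
qed

text \<open>Lets the later rounds on an extended bijection be replaced by the rounds on the smaller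
  one, which differs from it only at the two deleted positions.\<close>

lemma cross_cong:
  assumes "\<And>x. x \<in> P \<Longrightarrow> w x = w' x"
  shows "cross k w P = cross k w' P"
  using assms
proof (induction k arbitrary: P)
  case (Suc k)
  have "arg_min_on w P = arg_min_on w' P"
    by (rule arg_min_on_cong) (use Suc.prems in auto)
  moreover have "cross k w (P - X) = cross k w' (P - X)" for X
    by (rule Suc.IH) (use Suc.prems in auto)
  ultimately show ?case by (simp add: Let_def)
qed simp

lemma cross_subset:
  assumes "finite P" and "card P = 2 * k"
  shows "fst (cross k w P) \<subseteq> P" "snd (cross k w P) \<subseteq> P"
proof -
  have "fst (cross k w P) \<subseteq> P \<and> snd (cross k w P) \<subseteq> P"
    using assms
  proof (induction k arbitrary: P)
    case (Suc k)
    define b where "b = arg_min_on w P"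
    define a where "a = Min (P - {b})"
    have b: "b \<in> P"
      unfolding b_def using Suc.prems by (intro arg_min_if_finite(1)) auto
    have a: "a \<in> P - {b}"
      unfolding a_def using Suc.prems by (intro Min_Diff_singleton_in) auto
    have "card (P - {a, b}) = 2 * k"
      using Suc.prems a b by (simp add: card_Diff_subset)
    then have "fst (cross k w (P - {a, b})) \<subseteq> P \<and> snd (cross k w (P - {a, b})) \<subseteq> P"
      using Suc.IH[of "P - {a, b}"] Suc.prems by auto
    then show ?case
      using a b by (simp add: Let_def split: prod.split flip: b_def a_def) auto
  qed simp
  then show "fst (cross k w P) \<subseteq> P" "snd (cross k w P) \<subseteq> P" by auto
qed

section \<open>The two statistics under one round\<close>

text \<open>This and \<open>noninv_count\<close> are \<open>aa\<close> and \<open>z\<close> with the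
  sets of positions as parameters, so that they also apply to the smaller instances.\<close>

definition inv_count :: "nat set \<Rightarrow> (nat \<Rightarrow> nat) \<Rightarrow> nat" where
  "inv_count A w = card {(i, j). i \<in> A \<and> j \<in> A \<and> i < j \<and> w i > w j}"

definition noninv_count :: "nat set \<Rightarrow> nat set \<Rightarrow> (nat \<Rightarrow> nat) \<Rightarrow> nat" where
  "noninv_count P B w = card {(i, j). i \<in> P \<and> j \<in> P \<and> i < j \<and> w i < w j \<and> i \<in> B}"

text \<open>As \<open>a\<close> lies to the left of \<open>A\<close>, it can only be the left end of
  an inversion, one for each smaller value on \<open>A\<close>. Injectivity allows counting values
  instead of positions, and the values on \<open>A\<close> will be the remaining down steps.\<close>

lemma inv_count_insert_min:
  assumes "finite A" and "inj_on w A" and "\<And>x. x \<in> A \<Longrightarrow> a < x"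
    and "\<And>x. x \<in> A \<Longrightarrow> u x = w x"
  shows "inv_count (insert a A) u = card {d \<in> w ` A. d < u a} + inv_count A w"
proof -
  let ?I = "{(i, j). i \<in> A \<and> j \<in> A \<and> i < j \<and> w i > w j}"
  have "{(i, j). i \<in> insert a A \<and> j \<in> insert a A \<and> i < j \<and> u i > u j}
      = Pair a ` {j \<in> A. w j < u a} \<union> ?I"
    using assms(3,4) by force
  moreover have "card (Pair a ` {j \<in> A. w j < u a} \<union> ?I)
      = card (Pair a ` {j \<in> A. w j < u a}) + card ?I"
  proof (rule card_Un_disjoint)
    show "finite ?I" by (rule finite_subset[of _ "A \<times> A"]) (use assms(1) in auto)
    show "Pair a ` {j \<in> A. w j < u a} \<inter> ?I = {}" using assms(3) by fastforce
  qed (use assms(1) in simp)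
  moreover have "card (Pair a ` {j \<in> A. w j < u a}) = card {j \<in> A. w j < u a}"
    by (intro card_image) (auto simp: inj_on_def)
  moreover have "{d \<in> w ` A. d < u a} = w ` {j \<in> A. w j < u a}" by auto
  moreover have "card (w ` {j \<in> A. w j < u a}) = card {j \<in> A. w j < u a}"
    using assms(2) by (intro card_image) (auto intro: inj_on_subset)
  ultimately show ?thesis by (simp add: inv_count_def)
qed

text \<open>As \<open>u b\<close> is the least value, \<open>b\<close> pairs with every position to
  its right and is never the right end of a pair. Nor is \<open>a\<close> the right end of a pair
  starting in \<open>B\<close>, because it lies to the left of \<open>B\<close>.\<close>

lemma noninv_count_insert:
  assumes "finite P" and "a \<in> P" and "b \<in> P" and "a \<noteq> b"
    and "\<And>x. x \<in> P - {a, b} \<Longrightarrow> a < x" and "B \<subseteq> P - {a, b}"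
    and "\<And>x. x \<in> P - {a, b} \<Longrightarrow> u x = w x"
    and "\<And>x. x \<in> P \<Longrightarrow> x \<noteq> b \<Longrightarrow> u b < u x"
  shows "noninv_count P (insert b B) u
       = card {j \<in> P. b < j} + noninv_count (P - {a, b}) B w"
proof -
  let ?P = "P - {a, b}"
  let ?I = "{(i, j). i \<in> ?P \<and> j \<in> ?P \<and> i < j \<and> w i < w j \<and> i \<in> B}"
  have "{(i, j). i \<in> P \<and> j \<in> P \<and> i < j \<and> u i < u j \<and> i \<in> insert b B}
      = Pair b ` {j \<in> P. b < j} \<union> ?I" (is "?X = ?Y")
  proof (rule set_eqI, clarify)
    fix i j
    show "(i, j) \<in> ?X \<longleftrightarrow> (i, j) \<in> ?Y"
    proof (cases "i = b")
      case True
      then show ?thesis using assms(3,6,8) by auto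
    next
      case False
      show ?thesis
      proof (cases "i \<in> B")
        case True
        then have i: "i \<in> ?P" using assms(6) by auto
        then have "a < i" "u i = w i" "\<not> u i < u b"
          using assms(5,7) assms(8)[of i] by auto
        with True i False assms(7)[of j] show ?thesis by (cases "j = a"; cases "j = b") auto
      qed (use False in auto)
    qed
  qed
  moreover have "card ?Y = card (Pair b ` {j \<in> P. b < j}) + card ?I"
  proof (rule card_Un_disjoint)
    show "finite ?I" by (rule finite_subset[of _ "P \<times> P"]) (use assms(1) in auto)
  qed (use assms(1) in auto)
  moreover have "card (Pair b ` {j \<in> P. b < j}) = card {j \<in> P. b < j}"
    by (intro card_image) (auto simp: inj_on_def)
  ultimately show ?thesis by (simp add: noninv_count_def)
qed

section \<open>Heights of down steps under one round\<close>

text \<open>The starting height of the down step at \<open>d\<close>: up steps (at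
  \<open>V - D\<close>) before it minus down steps before it. Truncated subtraction turns negative
  heights into 0, where \<open>q_number\<close> vanishes.\<close>

definition down_ht :: "nat set \<Rightarrow> nat set \<Rightarrow> nat \<Rightarrow> nat" where
  "down_ht V D d = card {u \<in> V - D. u < d} - card {e \<in> D. e < d}"

text \<open>Deleting \<open>m\<close> removes an up step before every \<open>d\<close>. Deleting
  \<open>v\<close> removes a down step before those \<open>d\<close> beyond \<open>v\<close>, which
  cancels the loss there.\<close>

lemma down_ht_remove:
  assumes "finite V" and "D \<subseteq> V" and m: "m \<in> V" "m \<notin> D" "\<And>x. x \<in> V \<Longrightarrow> m \<le> x"
    and v: "v \<in> D" and d: "d \<in> D" "d \<noteq> v"
  shows "down_ht (V - {m, v}) (D - {v}) d = (if d < v then down_ht V D d - 1 else down_ht V D d)"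
proof -
  have fin: "finite D" using assms finite_subset by blast
  have "m < d" using m(3)[of d] assms by (metis subsetD le_neq_implies_less)
  have "{u \<in> (V - {m, v}) - (D - {v}). u < d} = {u \<in> V - D. u < d} - {m}" using v by auto
  then have 1: "card {u \<in> (V - {m, v}) - (D - {v}). u < d} = card {u \<in> V - D. u < d} - 1"
    using \<open>m < d\<close> m assms(1) by simp
  have 2: "{e \<in> D - {v}. e < d} = {e \<in> D. e < d} - {v}" by auto
  show ?thesis
  proof (cases "d < v")
    case True
    then have "{e \<in> D. e < d} - {v} = {e \<in> D. e < d}" by auto
    then show ?thesis using True 1 2 by (simp add: down_ht_def)
  next
    case False
    then have "v \<in> {e \<in> D. e < d}" using d v by auto
    then have "card {e \<in> D. e < d} = Suc (card ({e \<in> D. e < d} - {v}))"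
      using fin by (intro card.remove) auto
    then show ?thesis using False 1 2 by (simp add: down_ht_def)
  qed
qed

text \<open>This is the telescoping identity with \<open>j = 0\<close> and \<open>f d\<close> the
  number of up steps before \<open>d\<close>. The up step at \<open>Min V\<close> precedes every
  down step, so \<open>f\<close> is positive on \<open>D\<close>; equal numbers of up and down steps
  give the upper bound.\<close>

lemma sum_prod_down_ht_remove:
  fixes q :: "'a::comm_semiring_1"
  assumes "finite V" and "D \<subseteq> V" and "card V = 2 * card D" and "D \<noteq> {}" and "Min V \<notin> D"
  shows "(\<Sum>v\<in>D. q ^ card {e \<in> D. e < v} *
           (\<Prod>d\<in>D - {v}. q_number (down_ht (V - {Min V, v}) (D - {v}) d) q))
         = (\<Prod>d\<in>D. q_number (down_ht V D d) q)"
proof -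
  define f where "f d = card {u \<in> V - D. u < d}" for d
  have finD: "finite D" using assms finite_subset by blast
  have m: "Min V \<in> V" "\<And>x. x \<in> V \<Longrightarrow> Min V \<le> x"
    using assms by (auto intro!: Min_in)
  have ht: "down_ht V D d = f d - 0 - card {e \<in> D. e < d}" for d
    by (simp add: down_ht_def f_def)
  have "(\<Prod>d\<in>D - {v}. q_number (down_ht (V - {Min V, v}) (D - {v}) d) q)
      = (\<Prod>d | d \<in> D \<and> d < v. q_number (down_ht V D d - 1) q) *
        (\<Prod>d | d \<in> D \<and> v < d. q_number (down_ht V D d) q)" if v: "v \<in> D" for v
  proof -
    let ?k = "down_ht (V - {Min V, v}) (D - {v})"
    have k: "?k d = (if d < v then down_ht V D d - 1 else down_ht V D d)" if "d \<in> D" "d \<noteq> v" for d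
      using down_ht_remove[OF assms(1,2) m(1) assms(5) m(2) v that] by simp
    have "D - {v} = {d. d \<in> D \<and> d < v} \<union> {d. d \<in> D \<and> v < d}" by auto
    then have "(\<Prod>d\<in>D - {v}. q_number (?k d) q)
        = (\<Prod>d\<in>{d. d \<in> D \<and> d < v} \<union> {d. d \<in> D \<and> v < d}. q_number (?k d) q)"
      by (rule prod.cong) (rule refl)
    also have "\<dots> = (\<Prod>d | d \<in> D \<and> d < v. q_number (?k d) q) * (\<Prod>d | d \<in> D \<and> v < d. q_number (?k d) q)"
      using finD by (intro prod.union_disjoint) auto
    also have "(\<Prod>d | d \<in> D \<and> d < v. q_number (?k d) q)
        = (\<Prod>d | d \<in> D \<and> d < v. q_number (down_ht V D d - 1) q)"
      by (rule prod.cong) (auto simp: k)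
    also have "(\<Prod>d | d \<in> D \<and> v < d. q_number (?k d) q)
        = (\<Prod>d | d \<in> D \<and> v < d. q_number (down_ht V D d) q)"
      by (rule prod.cong) (auto simp: k)
    finally show ?thesis .
  qed
  then have "(\<Sum>v\<in>D. q ^ card {e \<in> D. e < v} *
           (\<Prod>d\<in>D - {v}. q_number (down_ht (V - {Min V, v}) (D - {v}) d) q))
    = (\<Sum>v\<in>D. q ^ card {e \<in> D. e < v} *
        ((\<Prod>d | d \<in> D \<and> d < v. q_number (down_ht V D d - 1) q) *
         (\<Prod>d | d \<in> D \<and> v < d. q_number (down_ht V D d) q)))"
    by simp
  also have "\<dots> = (\<Prod>d\<in>D. q_number (down_ht V D d) q)"
    unfolding ht
  proof (rule telescoping_q_numbers[OF finD \<open>D \<noteq> {}\<close>])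
    show "mono f"
      unfolding f_def mono_def using assms(1) by (intro allI impI card_mono) auto
    fix d assume d: "d \<in> D"
    have "Min V < d"
      using m(2)[of d] d assms by (metis subsetD le_neq_implies_less)
    then have "Min V \<in> {u \<in> V - D. u < d}" using m assms by auto
    then show "0 < f d"
      unfolding f_def using assms(1) by (auto simp: card_gt_0_iff)
    have "f d \<le> card (V - D)"
      unfolding f_def using assms(1) by (intro card_mono) auto
    also have "\<dots> = card D"
      using assms finD by (simp add: card_Diff_subset)
    finally show "f d \<le> 0 + card D" by simp
  qed
  finally show ?thesis .
qed

section \<open>The recursion and the induction on the number of rounds\<close>

text \<open>Since \<open>u\<close> takes its least value at \<open>b\<close>, the first round marks
  \<open>b\<close> and then \<open>a\<close>; the remaining rounds see only positions where
  \<open>u\<close> and \<open>w\<close> agree.\<close>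

lemma cross_extend:
  fixes P V :: "nat set"
  assumes fin: "finite P" and card: "card P = 2 * Suc k" and "finite V" "V \<noteq> {}"
    and b: "b \<in> P" and v: "v \<in> V - {Min V}" and a: "a = Min (P - {b})"
    and w: "w \<in> bijs (P - {a, b}) (V - {Min V, v})"
    and u: "u = w(b := Min V, a := v)" and cr: "cross k w (P - {a, b}) = (A, B)"
  shows "cross (Suc k) u P = (insert a A, insert b B)"
    and "u ` insert a A = insert v (w ` A)"
    and "inv_count (insert a A) u = card {d \<in> w ` A. d < v} + inv_count A w"
    and "noninv_count P (insert b B) u = card {j \<in> P. b < j} + noninv_count (P - {a, b}) B w"
    and "w ` A \<subseteq> V - {Min V, v}"
proof -
  have aP: "a \<in> P" "a \<noteq> b"
    using Min_Diff_singleton_in[OF fin, of b] card by (auto simp: a)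
  have cP: "card (P - {a, b}) = 2 * k"
    using aP b card fin by (simp add: card_Diff_subset)
  have AB: "A \<subseteq> P - {a, b}" "B \<subseteq> P - {a, b}"
    using cross_subset[OF _ cP, of w] fin cr by auto
  have amin: "a < x" if "x \<in> P - {a, b}" for x
    using that fin by (metis Diff_iff Min_le a finite_Diff insert_iff le_neq_implies_less)
  have wb: "bij_betw w (P - {a, b}) (V - {Min V, v})" using w by (simp add: bijs_def)
  have uw: "u x = w x" if "x \<in> P - {a, b}" for x using that by (simp add: u)
  have uV: "u x \<in> V - {Min V}" if "x \<in> P" "x \<noteq> b" for x
  proof (cases "x = a")
    case False
    then have "w x \<in> V - {Min V, v}" using bij_betwE[OF wb] that by blast
    then show ?thesis using uw[of x] that False by auto
  qed (use v in \<open>simp add: u\<close>)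
  have ub: "u b = Min V" using aP by (simp add: u)
  have less: "u b < u x" if "x \<in> P" "x \<noteq> b" for x
    using uV[OF that] \<open>finite V\<close> unfolding ub by (simp add: le_neq_implies_less)
  have "arg_min_on u P = b"
    by (rule arg_min_on_eqI) (use b less in auto)
  moreover have "cross k u (P - {a, b}) = (A, B)"
    using cross_cong[of "P - {a, b}" u w k] uw cr by simp
  ultimately show "cross (Suc k) u P = (insert a A, insert b B)"
    by (simp add: Let_def flip: a)
  have "u ` A = w ` A" using AB uw by (intro image_cong) auto
  moreover have ua: "u a = v" by (simp add: u)
  ultimately show "u ` insert a A = insert v (w ` A)" by simp
  have "inv_count (insert a A) u = card {d \<in> w ` A. d < u a} + inv_count A w"
  proof (rule inv_count_insert_min)
    show "finite A" using AB fin finite_subset by blast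
    show "inj_on w A" using wb AB by (auto simp: bij_betw_def intro: inj_on_subset)
  qed (use AB amin uw in auto)
  then show "inv_count (insert a A) u = card {d \<in> w ` A. d < v} + inv_count A w"
    by (simp only: ua)
  show "noninv_count P (insert b B) u = card {j \<in> P. b < j} + noninv_count (P - {a, b}) B w"
    by (rule noninv_count_insert[OF fin aP(1) b aP(2)]) (use amin AB uw less in auto)
  show "w ` A \<subseteq> V - {Min V, v}"
    using AB(1) wb by (metis bij_betw_imp_surj_on image_mono)
qed

text \<open>\<open>P\<close> and \<open>V\<close> are separate parameters because a round deletes
  the positions \<open>a\<close>, \<open>b\<close> but the values \<open>v\<close>,
  \<open>m\<close>, which differ in general.\<close>

lemma sum_bijs_cross:
  fixes q t :: "'a::comm_semiring_1"
  assumes "finite P" "finite V" "card P = 2 * n" "card V = 2 * n" "D \<subseteq> V" "card D = n"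
  shows "(\<Sum>w | w \<in> bijs P V \<and> w ` fst (cross n w P) = D.
            q ^ inv_count (fst (cross n w P)) w * t ^ noninv_count P (snd (cross n w P)) w)
         = (\<Prod>i=1..n. q_number (2 * i) t) * (\<Prod>d\<in>D. q_number (down_ht V D d) q)"
  using assms
proof (induction n arbitrary: P V D)
  case 0
  then have "P = {}" "V = {}" "D = {}" by auto
  moreover have "bijs {} {} = {\<lambda>x. x}" by (auto simp: bijs_def bij_betw_def)
  moreover have "{w. w = (\<lambda>x. x) \<and> w ` fst (cross 0 w {}) = {}} = {\<lambda>x::nat. x}" by auto
  ultimately show ?case by (simp add: inv_count_def noninv_count_def)
next
  case (Suc n)
  note fin = \<open>finite P\<close> \<open>finite V\<close>
  have finD: "finite D" using Suc.prems finite_subset by blast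
  have ne: "V \<noteq> {}" "D \<noteq> {}" using Suc.prems by auto
  define m where "m = Min V"
  have m: "m \<in> V" using fin ne by (simp add: m_def)
  \<comment> \<open>The condition on the image moves into the summand, so that the index set is all
    of \<open>bijs P V\<close> and can be reindexed.\<close>
  define F where "F k P D w = (if w ` fst (cross k w P) = D
      then q ^ inv_count (fst (cross k w P)) w * t ^ noninv_count P (snd (cross k w P)) w else 0)"
    for k P D w
  have F: "(\<Sum>w | w \<in> bijs P V \<and> w ` fst (cross k w P) = D.
        q ^ inv_count (fst (cross k w P)) w * t ^ noninv_count P (snd (cross k w P)) w)
      = (\<Sum>w\<in>bijs P V. F k P D w)" if "finite P" "finite V" for k P V D
    using finite_bijs[OF that] unfolding F_def
    by (subst sum.inter_filter[symmetric]) auto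
  define a where "a b = Min (P - {b})" for b
  have aP: "a b \<in> P" "a b \<noteq> b" for b
    using Min_Diff_singleton_in[OF fin(1), of b] Suc.prems(3) by (auto simp: a_def)
  have step: "F (Suc n) P D (w(b := m, a b := v))
      = (if v \<in> D \<and> m \<notin> D then t ^ card {j \<in> P. b < j} * (q ^ card {e \<in> D. e < v} *
          F n (P - {a b, b}) (D - {v}) w) else 0)"
    if b: "b \<in> P" and v: "v \<in> V - {m}" and w: "w \<in> bijs (P - {a b, b}) (V - {m, v})" for b v w
  proof -
    obtain A B where cr: "cross n w (P - {a b, b}) = (A, B)" by fastforce
    define u where "u = w(b := m, a b := v)"
    note ext = cross_extend[OF fin(1) Suc.prems(3) fin(2) ne(1) b v[unfolded m_def] a_def
        w[unfolded m_def] u_def[unfolded m_def] cr, folded m_def]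
    \<comment> \<open>The value \<open>v\<close> sits at an A-position and has to be a down step;
      \<open>m\<close> sits at a B-position and has to be an up step.\<close>
    have eq: "insert v (w ` A) = D \<longleftrightarrow> v \<in> D \<and> m \<notin> D \<and> w ` A = D - {v}"
      using ext(5) v by auto
    have "F (Suc n) P D u = (if insert v (w ` A) = D
        then q ^ (card {d \<in> w ` A. d < v} + inv_count A w) *
          t ^ (card {j \<in> P. b < j} + noninv_count (P - {a b, b}) B w) else 0)"
      unfolding F_def ext(1) fst_conv snd_conv ext(2,3,4) ..
    also have "\<dots> = (if v \<in> D \<and> m \<notin> D then t ^ card {j \<in> P. b < j} * (q ^ card {e \<in> D. e < v} *
          F n (P - {a b, b}) (D - {v}) w) else 0)"
    proof -
      have "{d \<in> D - {v}. d < v} = {e \<in> D. e < v}" by auto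
      then show ?thesis
        unfolding eq by (simp add: F_def cr power_add mult_ac)
    qed
    finally show ?thesis by (simp add: u_def)
  qed
  let ?T = "\<Prod>i=1..n. q_number (2 * i) t"
  have "(\<Sum>w\<in>bijs P V. F (Suc n) P D w)
      = (\<Sum>(b, v, w)\<in>(SIGMA b:P. SIGMA v:V - {m}. bijs (P - {a b, b}) (V - {m, v})).
          F (Suc n) P D (w(b := m, a b := v)))"
    using sum.reindex_bij_betw[OF bij_betw_bijs_extend[OF fin(1) _ m], of "F (Suc n) P D"]
      Suc.prems(3) by (simp add: case_prod_unfold a_def)
  also have "\<dots> = (\<Sum>b\<in>P. \<Sum>v\<in>V - {m}. \<Sum>w\<in>bijs (P - {a b, b}) (V - {m, v}).
          F (Suc n) P D (w(b := m, a b := v)))"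
    using fin by (subst sum.Sigma[symmetric]; (subst sum.Sigma[symmetric])?)
      (auto intro!: finite_SigmaI finite_bijs simp: sum.Sigma)
  also have "\<dots> = (\<Sum>b\<in>P. \<Sum>v\<in>V - {m}. if v \<in> D \<and> m \<notin> D then
      t ^ card {j \<in> P. b < j} * (q ^ card {e \<in> D. e < v} *
        (?T * (\<Prod>d\<in>D - {v}. q_number (down_ht (V - {m, v}) (D - {v}) d) q))) else 0)"
  proof (intro sum.cong refl)
    fix b v assume b: "b \<in> P" and v: "v \<in> V - {m}"
    let ?P = "P - {a b, b}" and ?V = "V - {m, v}"
    have "(\<Sum>w\<in>bijs ?P ?V. F (Suc n) P D (w(b := m, a b := v)))
      = (\<Sum>w\<in>bijs ?P ?V. if v \<in> D \<and> m \<notin> D then t ^ card {j \<in> P. b < j} *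
          (q ^ card {e \<in> D. e < v} * F n ?P (D - {v}) w) else 0)"
      by (rule sum.cong[OF refl]) (rule step[OF b v])
    also have "\<dots> = (if v \<in> D \<and> m \<notin> D then t ^ card {j \<in> P. b < j} *
          (q ^ card {e \<in> D. e < v} * (\<Sum>w\<in>bijs ?P ?V. F n ?P (D - {v}) w)) else 0)"
      by (cases "v \<in> D \<and> m \<notin> D")
        (simp_all only: simp_thms if_True if_False sum_distrib_left sum.neutral_const)
    also have "\<dots> = (if v \<in> D \<and> m \<notin> D then t ^ card {j \<in> P. b < j} *
      (q ^ card {e \<in> D. e < v} *
        (?T * (\<Prod>d\<in>D - {v}. q_number (down_ht ?V (D - {v}) d) q))) else 0)"
    proof (cases "v \<in> D \<and> m \<notin> D")
      case True
      have "(\<Sum>w\<in>bijs ?P ?V. F n ?P (D - {v}) w)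
          = ?T * (\<Prod>d\<in>D - {v}. q_number (down_ht ?V (D - {v}) d) q)"
      proof (subst F[symmetric])
        show "(\<Sum>w | w \<in> bijs ?P ?V \<and> w ` fst (cross n w ?P) = D - {v}.
            q ^ inv_count (fst (cross n w ?P)) w * t ^ noninv_count ?P (snd (cross n w ?P)) w)
          = ?T * (\<Prod>d\<in>D - {v}. q_number (down_ht ?V (D - {v}) d) q)"
        proof (rule Suc.IH)
          show "card ?P = 2 * n"
            using aP[of b] b fin Suc.prems by (simp add: card_Diff_subset)
          show "card ?V = 2 * n"
            using m v fin Suc.prems by (simp add: card_Diff_subset)
          show "card (D - {v}) = n" using True finD Suc.prems by simp
        qed (use fin True Suc.prems in auto)
      qed (use fin in auto)
      then show ?thesis by simp
    qed auto
    finally show "(\<Sum>w\<in>bijs ?P ?V. F (Suc n) P D (w(b := m, a b := v))) = \<dots>" .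
  qed
  also have "\<dots> = (\<Prod>i=1..Suc n. q_number (2 * i) t) * (\<Prod>d\<in>D. q_number (down_ht V D d) q)"
  proof (cases "m \<in> D")
    case True
    \<comment> \<open>A down step at the least value has height 0, so the product is zero, matching
      the summands, whose condition \<open>m \<notin> D\<close> fails.\<close>
    have "{u \<in> V - D. u < m} = {}" using Min_le[OF fin(2)] by (force simp: m_def)
    then have "down_ht V D m = 0" by (simp only: down_ht_def card.empty diff_0_eq_0)
    then have "(\<Prod>d\<in>D. q_number (down_ht V D d) q) = 0"
      using True finD by (intro prod_zero) (auto intro!: bexI[of _ m])
    then show ?thesis using True by simp
  next
    case False
    let ?g = "\<lambda>v. q ^ card {e \<in> D. e < v} *
        (\<Prod>d\<in>D - {v}. q_number (down_ht (V - {m, v}) (D - {v}) d) q)"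
    have VD: "(V - {m}) \<inter> D = D" using False Suc.prems by auto
    have inner: "(\<Sum>v\<in>V - {m}. if v \<in> D \<and> m \<notin> D then x * (q ^ card {e \<in> D. e < v} *
        (?T * (\<Prod>d\<in>D - {v}. q_number (down_ht (V - {m, v}) (D - {v}) d) q))) else 0)
        = x * ?T * (\<Sum>v\<in>D. ?g v)" for x
    proof -
      have "(\<Sum>v\<in>V - {m}. if v \<in> D \<and> m \<notin> D then x * (q ^ card {e \<in> D. e < v} *
        (?T * (\<Prod>d\<in>D - {v}. q_number (down_ht (V - {m, v}) (D - {v}) d) q))) else 0)
        = (\<Sum>v\<in>V - {m}. if v \<in> D then x * ?T * ?g v else 0)"
        using False by (intro sum.cong) (auto simp: mult_ac)
      also have "\<dots> = (\<Sum>v\<in>(V - {m}) \<inter> D. x * ?T * ?g v)"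
        using fin by (intro sum.inter_restrict[symmetric]) auto
      finally show ?thesis unfolding VD by (simp only: sum_distrib_left)
    qed
    have outer: "(\<Sum>v\<in>D. ?g v) = (\<Prod>d\<in>D. q_number (down_ht V D d) q)"
      unfolding m_def by (rule sum_prod_down_ht_remove) (use Suc.prems ne False m_def in auto)
    \<comment> \<open>The new factor, for \<open>i = Suc n\<close>, is the sum over the positions
      \<open>b\<close>, as \<open>card P = 2 * Suc n\<close>.\<close>
    have "(\<Prod>i=1..Suc n. q_number (2 * i) t) = (\<Sum>b\<in>P. t ^ card {j \<in> P. b < j}) * ?T"
      unfolding sum_power_card_greater[OF fin(1)] Suc.prems(3) by (simp add: mult.commute)
    then show ?thesis
      unfolding inner outer by (simp only: sum_distrib_right)
  qed
  finally show ?case unfolding F[OF fin] .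
qed

section \<open>Translation back to Dyck paths\<close>

lemma path_of_downs_down_positions:
  assumes "length p = 2 * n"
  shows "path_of_downs n (down_positions p) = p"
proof (rule nth_equalityI)
  fix i assume "i < length (path_of_downs n (down_positions p))"
  then have i: "i < 2 * n" by (simp add: path_of_downs_def del: upt_Suc)
  then show "path_of_downs n (down_positions p) ! i = p ! i"
    using assms by (cases "p ! i") (auto simp: path_of_downs_def down_positions_def simp del: upt_Suc)
qed (use assms in \<open>simp add: path_of_downs_def del: upt_Suc\<close>)

text \<open>Final height 0 means that half of the \<open>2 * n\<close> steps go down.\<close>

lemma card_down_positions:
  assumes "dyck_path n p"
  shows "card (down_positions p) = n"
proof -
  let ?D = "down_positions p"
  have len: "length p = 2 * n" using assms by (simp add: dyck_path_def)
  then have D: "?D \<subseteq> {1..2 * n}" by (auto simp: down_positions_def)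
  have "int (card ({1..2 * n} - ?D)) - int (card ({1..2 * n} \<inter> ?D)) = 0"
    using path_height_path_of_downs[of "2 * n" n ?D] assms
    by (simp add: path_of_downs_down_positions[OF len] dyck_path_def)
  moreover have "{1..2 * n} \<inter> ?D = ?D" using D by auto
  moreover have "card ({1..2 * n} - ?D) = 2 * n - card ?D"
    using D by (subst card_Diff_subset) (auto intro: finite_subset)
  moreover have "card ?D \<le> 2 * n" using card_mono[OF _ D] by simp
  ultimately show ?thesis by simp
qed

text \<open>The step ending at \<open>d\<close> starts at \<open>d - 1\<close>, so the steps before
  it are those at positions below \<open>d\<close>. Here \<open>nat\<close> truncates just as the
  subtraction in \<open>down_ht\<close> does.\<close>

lemma path_height_down_ht:
  assumes "length p = 2 * n" and "d \<in> down_positions p"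
  shows "nat (path_height p (d - 1)) = down_ht {1..2 * n} (down_positions p) d"
proof -
  let ?D = "down_positions p"
  have D: "?D \<subseteq> {1..2 * n}" using assms by (auto simp: down_positions_def)
  with assms have d: "1 \<le> d" "d \<le> 2 * n" by auto
  have "{1..d - 1} - ?D = {u \<in> {1..2 * n} - ?D. u < d}" "{1..d - 1} \<inter> ?D = {e \<in> ?D. e < d}"
    using d D by auto
  then show ?thesis
    using path_height_path_of_downs[of "d - 1" n ?D] d
    by (simp add: path_of_downs_down_positions[OF assms(1)] down_ht_def)
qed

text \<open>The sorted list enumerates the down positions without repetition, so the product over
  indices becomes one over the set; the shift by one matches counting down steps from 1.\<close>

lemma prod_down_height:
  assumes "dyck_path n p"
  shows "(\<Prod>i=1..n. f (down_height p i)) = (\<Prod>d\<in>down_positions p. f (down_ht {1..2 * n} (down_positions p) d))"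
proof -
  let ?D = "down_positions p"
  let ?xs = "sorted_list_of_set ?D"
  have len: "length p = 2 * n" using assms by (simp add: dyck_path_def)
  have fin: "finite ?D" by (simp add: down_positions_def)
  have n: "length ?xs = n" using card_down_positions[OF assms] by simp
  have "bij_betw (\<lambda>i. ?xs ! (i - 1)) {1..n} ?D"
  proof -
    have "bij_betw ((!) ?xs) {..<n} ?D"
      using n fin by (intro bij_betw_nth) auto
    moreover have "bij_betw (\<lambda>i. i - 1) {1..n} {..<n}"
      by (rule bij_betw_byWitness[where f' = Suc]) auto
    ultimately show ?thesis using bij_betw_trans by (fastforce simp: o_def)
  qed
  note bij = this
  have "(\<Prod>d\<in>?D. f (down_ht {1..2 * n} ?D d)) = (\<Prod>d\<in>?D. f (nat (path_height p (d - 1))))"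
    by (rule prod.cong[OF refl]) (simp only: path_height_down_ht[OF len])
  also have "\<dots> = (\<Prod>i=1..n. f (nat (path_height p (?xs ! (i - 1) - 1))))"
    by (rule prod.reindex_bij_betw[OF bij, symmetric])
  finally show ?thesis by (simp add: down_height_def)
qed

theorem theorem6:
  fixes n :: nat and \<alpha> :: "step list"
  assumes "n \<ge> 1" and "dyck_path n \<alpha>"
  shows "(\<Sum>w | w permutes {1..2 * n} \<and> p_A n w = \<alpha>. q_var ^ aa n w * t_var ^ z n w)
           = (\<Prod>i=1..n. q_number (2 * i) t_var) * (\<Prod>i=1..n. q_number (down_height \<alpha> i) q_var)"
proof -
  let ?P = "{1..2 * n}" and ?D = "down_positions \<alpha>"
  have len: "length \<alpha> = 2 * n" using assms(2) by (simp add: dyck_path_def)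
  \<comment> \<open>A path is determined by its down positions, so the condition on
    \<open>p_A\<close> becomes one on the set of values at the A-positions.\<close>
  have pA: "p_A n w = \<alpha> \<longleftrightarrow> w ` marked_A n w = ?D" if "w permutes ?P" for w
    using down_positions_p_A[OF that] path_of_downs_down_positions[OF len]
    by (auto simp: p_A_def)
  have z: "z n w = noninv_count ?P (marked_B n w) w" for w
    by (simp add: z_def noninv_count_def)
  have aa: "aa n w = inv_count (marked_A n w) w" for w
    by (simp add: aa_def inv_count_def)
  have "(\<Sum>w | w permutes ?P \<and> p_A n w = \<alpha>. q_var ^ aa n w * t_var ^ z n w)
      = (\<Sum>w | w \<in> bijs ?P ?P \<and> w ` fst (cross n w ?P) = ?D. q_var ^ inv_count (fst (cross n w ?P)) w *
          t_var ^ noninv_count ?P (snd (cross n w ?P)) w)"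
    unfolding bijs_self mem_Collect_eq aa z marked_cross[symmetric]
    by (rule sum.cong) (use pA in auto)
  also have "\<dots> = (\<Prod>i=1..n. q_number (2 * i) t_var) *
      (\<Prod>d\<in>?D. q_number (down_ht ?P ?D d) q_var)"
    by (rule sum_bijs_cross) (use card_down_positions[OF assms(2)] len in \<open>auto simp: down_positions_def\<close>)
  also have "(\<Prod>d\<in>?D. q_number (down_ht ?P ?D d) q_var) = (\<Prod>i=1..n. q_number (down_height \<alpha> i) q_var)"
    by (rule prod_down_height[OF assms(2), symmetric])
  finally show ?thesis .
qed

end
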